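(* Let $n$ be a positive integer and let $S,T$ be nonempty subsets of $[n-1]$ satisfying $\min S+\min T\le n$ and $\max\{\max S,\max T\}\le n-\gcd(\min S,\min T)$. Then $T_n\langle S;T\rangle$ is a walk-ensured Toeplitz matrix.
   Context: Matrices are Boolean ($0,1$ entries with $1+1=1$). For nonempty $S,T\subseteq[n-1]$, $T_n\langle S;T\rangle$ denotes the $n\times n$ $(0,1)$-matrix whose $(i,j)$-entry is $1$ if and only if $j-i\in S$ or $i-j\in T$. Its digraph $D(A)$ has vertex set $[n]$ and an arc $(i,j)$ exactly when the $(i,j)$-entry is $1$. Let $s_1=\min S$ and $\gcd(S+T)=\gcd\{s+t: s\in S,t\in T\}$. The matrix $A=T_n\langle S;T\rangle$ is called walk-ensured if there is a positive integer $M$ such that for all vertices $u,v\in[n]$ and every integer $\ell\ge M$ with $v-u\equiv \ell s_1 \pmod{\gcd(S+T)}$, there is a directed walk from $u$ to $v$ of length $\ell$ in $D(A)$. *)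

theory Defs
  imports
    "Jordan_Normal_Form.Matrix"
    "Graph_Theory.Pair_Digraph"
    "HOL-Number_Theory.Cong"
begin

text \<open>
  Boolean matrices are matrices over \<open>bool\<close>, with \<open>True\<close> for the entry 1 and \<open>False\<close> for 0
  (disjunction is the sum, so 1 + 1 = 1). Matrix indices start at 0, whereas the vertex set of
  the digraph is \<open>{1..n}\<close>; the mathematical \<open>(i, j)\<close>-entry is \<open>A $$ (i - 1, j - 1)\<close>.
\<close>

definition toeplitz_mat :: "'a mat \<Rightarrow> bool" where
  "toeplitz_mat A \<longleftrightarrow> square_mat A \<and>
     (\<forall>i j. Suc i < dim_row A \<longrightarrow> Suc j < dim_col A \<longrightarrow> A $$ (Suc i, Suc j) = A $$ (i, j))"

text \<open>
  The matrix \<open>T\<^sub>n\<langle>S;T\<rangle>\<close>. The shift of the indices does not affect the differences; these are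
  taken in \<open>int\<close> because subtraction on \<open>nat\<close> truncates.
\<close>

definition toeplitz_of :: "nat \<Rightarrow> nat set \<Rightarrow> nat set \<Rightarrow> bool mat" where
  "toeplitz_of n S T =
     mat n n (\<lambda>(i, j). int j - int i \<in> int ` S \<or> int i - int j \<in> int ` T)"

definition mat_digraph :: "bool mat \<Rightarrow> nat pair_pre_digraph" where
  "mat_digraph A =
     \<lparr> pverts = {1..dim_row A},
       parcs = {(i, j). i \<in> {1..dim_row A} \<and> j \<in> {1..dim_col A} \<and> A $$ (i - 1, j - 1)} \<rparr>"

text \<open>
  A property of the matrix \<open>toeplitz_of n S T\<close>; for \<open>S, T \<subseteq> {1..n - 1}\<close> the matrix determines
  \<open>n\<close>, \<open>S\<close> and \<open>T\<close>, which are passed directly because \<open>Min S\<close> and the gcd refer to them.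
  An \<open>awalk\<close> is a list of arcs, so its length is the number of arcs.
\<close>

definition walk_ensured :: "nat \<Rightarrow> nat set \<Rightarrow> nat set \<Rightarrow> bool" where
  "walk_ensured n S T \<longleftrightarrow>
     (\<exists>M > 0. \<forall>u \<in> {1..n}. \<forall>v \<in> {1..n}. \<forall>l \<ge> M.
        [int v - int u = int l * int (Min S)] (mod int (Gcd {s + t |s t. s \<in> S \<and> t \<in> T})) \<longrightarrow>
        (\<exists>p. pre_digraph.awalk (with_proj (mat_digraph (toeplitz_of n S T))) u p v \<and> length p = l))"

end

theory Submission
  imports Defs
begin

text \<open>
  Write \<open>s = Min S\<close>, \<open>t = Min T\<close>, \<open>g = s + t\<close> and \<open>d = gcd s t\<close>. Since \<open>g \<le> n\<close>, a vertex
  from which \<open>+s\<close> leaves \<open>[n]\<close> admits \<open>-t\<close>; hence \<open>a\<close> steps \<open>+s\<close> and \<open>b\<close> steps \<open>-t\<close> can be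
  ordered into a walk from \<open>u\<close> to \<open>v\<close> whenever \<open>v = u + a s - b t\<close>. So all sufficiently long
  walks with \<open>v - u \<equiv> l s (mod g)\<close> exist. Call \<open>x\<close> an admissible offset if all sufficiently long
  walks with \<open>v - u \<equiv> l s + x (mod g)\<close> exist. Concatenating walks shows that the admissible
  offsets form a subgroup of the integers. The bound \<open>n - d\<close> on \<open>S\<close> and \<open>T\<close> guarantees that every
  step is available at some vertex of every residue class modulo \<open>d\<close>, and that vertex is reached
  by steps \<open>+s\<close> and \<open>-t\<close>; so \<open>s' - s\<close> and \<open>-t' - s\<close> are admissible offsets for all \<open>s' \<in> S\<close> and
  \<open>t' \<in> T\<close>. Their differences \<open>s' + t'\<close> generate the multiples of the gcd of \<open>S + T\<close>.
\<close>

section \<open>Walks as relational powers of the arc relation\<close>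

definition toeplitz_arcs :: "nat \<Rightarrow> nat set \<Rightarrow> nat set \<Rightarrow> (nat \<times> nat) set" where
  "toeplitz_arcs n S T = {(i, j). i \<in> {1..n} \<and> j \<in> {1..n} \<and>
     ((\<exists>s\<in>S. j = i + s) \<or> (\<exists>t\<in>T. i = j + t))}"

lemma toeplitz_mat_toeplitz_of: "toeplitz_mat (toeplitz_of n S T)"
  by (auto simp: toeplitz_mat_def toeplitz_of_def)

lemma pverts_mat_digraph_toeplitz_of: "pverts (mat_digraph (toeplitz_of n S T)) = {1..n}"
  by (simp add: mat_digraph_def toeplitz_of_def)

text \<open>Vertices are at least 1, so \<open>i - 1\<close> does not truncate and the shift of
  matrix indices cancels in the differences.\<close>

lemma parcs_mat_digraph_toeplitz_of:
  "parcs (mat_digraph (toeplitz_of n S T)) = toeplitz_arcs n S T"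
proof -
  have *: "(int (j - 1) - int (i - 1) \<in> int ` S \<or> int (i - 1) - int (j - 1) \<in> int ` T) \<longleftrightarrow>
    (\<exists>s\<in>S. j = i + s) \<or> (\<exists>t\<in>T. i = j + t)" if "i \<ge> 1" "j \<ge> 1" for i j :: nat
  proof -
    have "int (j - 1) - int (i - 1) = int x \<longleftrightarrow> j = i + x" for x
      using that by linarith
    moreover have "int (i - 1) - int (j - 1) = int x \<longleftrightarrow> i = j + x" for x
      using that by linarith
    ultimately show ?thesis
      unfolding image_iff by simp
  qed
  have "(i, j) \<in> parcs (mat_digraph (toeplitz_of n S T)) \<longleftrightarrow> (i, j) \<in> toeplitz_arcs n S T" for i j
  proof (cases "i \<in> {1..n} \<and> j \<in> {1..n}")
    case True
    then have "i - 1 < n" "j - 1 < n" by auto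
    then show ?thesis
      using True *[of i j] by (simp add: mat_digraph_def toeplitz_of_def toeplitz_arcs_def)
  next
    case False
    then show ?thesis
      by (auto simp: mat_digraph_def toeplitz_of_def toeplitz_arcs_def)
  qed
  then show ?thesis
    by (simp add: set_eq_iff split_paired_All)
qed

lemma awalk_of_relpow:
  assumes "(u, v) \<in> parcs G ^^ l" "u \<in> pverts G" "parcs G \<subseteq> pverts G \<times> pverts G"
  shows "\<exists>p. pre_digraph.awalk (with_proj G) u p v \<and> length p = l"
  using assms(1,2)
proof (induction l arbitrary: u)
  case 0
  then show ?case
    by (auto simp: pre_digraph.awalk_def pre_digraph.cas.simps)
next
  case (Suc l)
  then obtain w where w: "(u, w) \<in> parcs G" "(w, v) \<in> parcs G ^^ l"
    by (meson relpow_Suc_D2)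
  with assms(3) have "w \<in> pverts G" by blast
  with Suc.IH w obtain p where "pre_digraph.awalk (with_proj G) w p v" "length p = l"
    by blast
  then have "pre_digraph.awalk (with_proj G) u ((u, w) # p) v \<and> length ((u, w) # p) = Suc l"
    using w Suc.prems by (auto simp: pre_digraph.awalk_def pre_digraph.cas.simps)
  then show ?case by blast
qed

text \<open>The balance \<open>u + a * s = v + b * t\<close> is an invariant of the remaining steps:
  taking one step moves \<open>u\<close> and lowers \<open>a\<close> or \<open>b\<close> by one. It
  remains to see that some remaining step stays inside \<open>{1..n}\<close>.\<close>

lemma relpow_two_steps:
  assumes "s \<in> S" "t \<in> T" "s + t \<le> n" "u \<in> {1..n}" "v \<in> {1..n}" "u + a * s = v + b * t"
  shows "(u, v) \<in> toeplitz_arcs n S T ^^ (a + b)"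
  using assms(4,6)
proof (induction "a + b" arbitrary: a b u)
  case 0
  then show ?case by simp
next
  case (Suc k)
  consider "a > 0" "u + s \<le> n" | "b > 0" "u > t"
  proof -
    have "a > 0 \<and> u + s \<le> n \<or> b > 0 \<and> u > t"
    proof (rule ccontr)
      assume neg: "\<not> ?thesis"
      \<comment> \<open>If only one kind of step remains, the target \<open>v\<close> lies in that
        direction, so the step cannot leave \<open>{1..n}\<close>. If both remain and both fail,
        then \<open>u + s > n\<close> and \<open>u \<le> t\<close>, against
        \<open>s + t \<le> n\<close>.\<close>
      consider "a = 0" "b > 0" | "b = 0" "a > 0" | "a > 0" "b > 0"
        using Suc.hyps by linarith
      then show False
      proof cases
        case 1
        then have "u = v + b * t" "b * t \<ge> t" using Suc.prems by auto
        moreover have "v \<ge> 1" using assms(5) by simp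
        ultimately have "u > t" by linarith
        then show False using 1 neg by simp
      next
        case 2
        then have "u + a * s = v" "a * s \<ge> s" using Suc.prems by auto
        moreover have "v \<le> n" using assms(5) by simp
        ultimately have "u + s \<le> n" by linarith
        then show False using 2 neg by simp
      next
        case 3
        then show False using neg assms(3) by linarith
      qed
    qed
    then show thesis using that by blast
  qed
  then show ?case
  proof cases
    case 1
    then obtain a' where a': "a = Suc a'" using gr0_implies_Suc by blast
    have "(u + s, v) \<in> toeplitz_arcs n S T ^^ (a' + b)"
      using Suc.hyps(2) Suc.prems 1 a' by (intro Suc.hyps(1)) auto
    moreover have "(u, u + s) \<in> toeplitz_arcs n S T"
      using Suc.prems 1 assms(1) by (auto simp: toeplitz_arcs_def)
    ultimately show ?thesis
      unfolding a' add_Suc by (rule relpow_Suc_I2[rotated])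
  next
    case 2
    then obtain b' where b': "b = Suc b'" using gr0_implies_Suc by blast
    have "(u - t, v) \<in> toeplitz_arcs n S T ^^ (a + b')"
      using Suc.hyps(2) Suc.prems 2 b' by (intro Suc.hyps(1)) auto
    moreover have "u = (u - t) + t" "u - t \<in> {1..n}" using Suc.prems 2 by auto
    then have "(u, u - t) \<in> toeplitz_arcs n S T"
      using Suc.prems(1) assms(2) unfolding toeplitz_arcs_def by blast
    ultimately show ?thesis
      unfolding b' add_Suc_right by (rule relpow_Suc_I2[rotated])
  qed
qed

text \<open>Inserting one element replaces the gcd by a Bezout combination, and \<open>H\<close> is
  closed under those; the empty set has gcd 0.\<close>

lemma Gcd_mem_int_subgroup:
  fixes H :: "int set" and K :: "nat set"
  assumes "finite K" "int ` K \<subseteq> H" "0 \<in> H"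
    and add: "\<And>x y. x \<in> H \<Longrightarrow> y \<in> H \<Longrightarrow> x + y \<in> H"
    and mult: "\<And>k x. x \<in> H \<Longrightarrow> k * x \<in> H"
  shows "int (Gcd K) \<in> H"
  using assms(1,2)
proof (induction K)
  case empty
  then show ?case using assms(3) by simp
next
  case (insert a K)
  obtain p q where "p * int a + q * int (Gcd K) = gcd (int a) (int (Gcd K))"
    using bezout_int by blast
  moreover have "p * int a + q * int (Gcd K) \<in> H"
    using insert by (auto intro!: add mult)
  ultimately show ?case by (simp flip: gcd_int_int_eq)
qed

section \<open>Admissible offsets modulo \<open>s + t\<close>\<close>

locale toeplitz_pair =
  fixes n :: nat and S T :: "nat set" and s t :: nat
  assumes s: "s \<in> S" "s > 0" and t: "t \<in> T" "t > 0" and sum_le: "s + t \<le> n"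
    and S_le: "\<And>x. x \<in> S \<Longrightarrow> x \<le> n - gcd s t"
    and T_le: "\<And>x. x \<in> T \<Longrightarrow> x \<le> n - gcd s t"
begin

text \<open>The threshold for \<open>l\<close> is uniform in \<open>u\<close> and \<open>v\<close>,
  so that walks can be concatenated at any intermediate vertex.\<close>

definition offset :: "int \<Rightarrow> bool" where
  "offset x \<longleftrightarrow> (\<forall>\<^sub>F l in sequentially. \<forall>u\<in>{1..n}. \<forall>v\<in>{1..n}.
     [int v - int u = int l * int s + x] (mod int (s + t)) \<longrightarrow>
     (u, v) \<in> toeplitz_arcs n S T ^^ l)"

lemma offset_cong:
  assumes "offset x" "[x = y] (mod int (s + t))"
  shows "offset y"
proof -
  have "[c = int l * int s + x] (mod int (s + t)) \<longleftrightarrow> [c = int l * int s + y] (mod int (s + t))"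
    for c l
    using assms(2) by (meson cong_add_lcancel cong_sym cong_trans)
  then show ?thesis
    using assms(1) by (simp add: offset_def)
qed

text \<open>A walk of length \<open>l\<close> needs \<open>a + b = l\<close> and
  \<open>a * s - b * t = v - u\<close>. Hence \<open>b\<close> is the quotient of
  \<open>l * s - (v - u)\<close> by \<open>s + t\<close>, and \<open>a\<close> is
  \<open>l - b\<close>.\<close>

lemma offset_0: "offset 0"
  unfolding offset_def eventually_sequentially
proof (intro exI[of _ n] allI impI ballI)
  fix l u v
  assume l: "n \<le> l" and u: "u \<in> {1..n}" and v: "v \<in> {1..n}"
    and "[int v - int u = int l * int s + 0] (mod int (s + t))"
  then have "int (s + t) dvd int l * int s - (int v - int u)"
    by (simp add: cong_iff_dvd_diff dvd_diff_commute)
  then obtain b where b: "int l * int s - (int v - int u) = int (s + t) * b"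
    by (elim dvdE)
  \<comment> \<open>Both products exceed the absolute value of \<open>v - u\<close>, which is less
    than \<open>n\<close>; this makes \<open>b\<close> and \<open>l - b\<close> nonnegative.\<close>
  have ls: "int l * int s \<ge> int n" "int l * int t \<ge> int n"
    using l s t by (metis mult_le_mono nat_mult_1_right of_nat_le_iff of_nat_mult Suc_leI One_nat_def)+
  have "int (s + t) * b \<ge> 0" using ls u v b by auto
  then have "b \<ge> 0" using s by (simp add: zero_le_mult_iff)
  have "int (s + t) * (int l - b) = int l * int t + (int v - int u)"
    using b by (simp add: algebra_simps)
  then have "int (s + t) * (int l - b) \<ge> 0" using ls u v by auto
  then have "int l - b \<ge> 0" using s by (simp add: zero_le_mult_iff)
  define a' b' where "a' = nat (int l - b)" and "b' = nat b"
  have ab: "int a' = int l - b" "int b' = b"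
    using \<open>b \<ge> 0\<close> \<open>int l - b \<ge> 0\<close> by (auto simp: a'_def b'_def)
  have "int (u + a' * s) = int (v + b' * t)"
    using b by (simp add: ab algebra_simps)
  then have "(u, v) \<in> toeplitz_arcs n S T ^^ (a' + b')"
    using relpow_two_steps s t sum_le u v of_nat_eq_iff by blast
  moreover have "a' + b' = l" using ab by linarith
  ultimately show "(u, v) \<in> toeplitz_arcs n S T ^^ l" by simp
qed

lemma ex_vertex_cong: "\<exists>w\<in>{1..n}. [int w = c] (mod int (s + t))"
proof -
  \<comment> \<open>Since \<open>s + t \<le> n\<close>, the vertices 1 to \<open>s + t\<close> form
    a complete residue system; the shift by 1 is there because vertices start at 1.\<close>
  define r where "r = (c - 1) mod int (s + t)"
  have r: "0 \<le> r" "r < int (s + t)" using s by (auto simp: r_def)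
  have "[r + 1 = c - 1 + 1] (mod int (s + t))"
    unfolding r_def by (intro cong_add cong_refl) simp
  moreover have "int (nat (r + 1)) = r + 1" using r by simp
  ultimately show ?thesis
    using r sum_le by (intro bexI[of _ "nat (r + 1)"]) auto
qed

lemma offset_add:
  assumes "offset x" "offset y"
  shows "offset (x + y)"
proof -
  obtain M where M: "\<And>l u v. l \<ge> M \<Longrightarrow> u \<in> {1..n} \<Longrightarrow> v \<in> {1..n} \<Longrightarrow>
    [int v - int u = int l * int s + x] (mod int (s + t)) \<Longrightarrow> (u, v) \<in> toeplitz_arcs n S T ^^ l"
    using assms(1) unfolding offset_def eventually_sequentially by blast
  obtain N where N: "\<And>l u v. l \<ge> N \<Longrightarrow> u \<in> {1..n} \<Longrightarrow> v \<in> {1..n} \<Longrightarrow>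
    [int v - int u = int l * int s + y] (mod int (s + t)) \<Longrightarrow> (u, v) \<in> toeplitz_arcs n S T ^^ l"
    using assms(2) unfolding offset_def eventually_sequentially by blast
  show ?thesis
    unfolding offset_def eventually_sequentially
  proof (intro exI[of _ "M + N"] allI impI ballI)
    fix l u v
    assume l: "M + N \<le> l" and u: "u \<in> {1..n}" and v: "v \<in> {1..n}"
      and uv: "[int v - int u = int l * int s + (x + y)] (mod int (s + t))"
    \<comment> \<open>The intermediate vertex is chosen so that exactly \<open>M\<close> steps
      realize offset \<open>x\<close>; the other \<open>l - M \<ge> N\<close> steps realize
      \<open>y\<close>.\<close>
    obtain w where w: "w \<in> {1..n}" "[int w = int u + (int M * int s + x)] (mod int (s + t))"
      using ex_vertex_cong by blast
    have "[int w - int u = int M * int s + x] (mod int (s + t))"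
      using w(2) by (simp add: cong_iff_dvd_diff algebra_simps)
    then have uw: "(u, w) \<in> toeplitz_arcs n S T ^^ M" using M u w by blast
    have "[int v - int u - (int w - int u) = int l * int s + (x + y) - (int M * int s + x)]
        (mod int (s + t))"
      by (intro cong_diff) fact+
    then have "[int v - int w = int (l - M) * int s + y] (mod int (s + t))"
      using l by (simp add: of_nat_diff algebra_simps)
    then have "(w, v) \<in> toeplitz_arcs n S T ^^ (l - M)"
      using l v w by (intro N) auto
    with uw have "(u, v) \<in> toeplitz_arcs n S T ^^ (M + (l - M))"
      unfolding relpow_add by blast
    then show "(u, v) \<in> toeplitz_arcs n S T ^^ l" using l by simp
  qed
qed

lemma offset_mult:
  assumes "offset x"
  shows "offset (k * x)"
proof -
  have nat_mult: "offset (int m * x)" for m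
    by (induction m) (auto simp: offset_0 distrib_right intro: offset_add assms)
  \<comment> \<open>Offsets matter only modulo \<open>s + t\<close>, so a negative factor can be
    replaced by its nonnegative residue. This provides inverses without reversing walks.\<close>
  have "k mod int (s + t) \<ge> 0" using s by simp
  then have "offset ((k mod int (s + t)) * x)"
    using nat_mult[of "nat (k mod int (s + t))"] by simp
  moreover have "[k mod int (s + t) * x = k * x] (mod int (s + t))"
    by (intro cong_mult cong_refl) simp
  ultimately show ?thesis by (rule offset_cong)
qed

section \<open>Offsets contributed by the other arcs\<close>

lemma ex_length_cong:
  assumes "int (gcd s t) dvd c"
  shows "\<exists>l\<ge>M. l < M + (s + t) \<and> [c = int l * int s] (mod int (s + t))"
proof -
  obtain z where z: "[int s * z = gcd (int s) (int (s + t))] (mod int (s + t))"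
    using cong_solve_int by blast
  have gcd: "gcd (int s) (int (s + t)) = int (gcd s t)"
    by (metis gcd_add2 gcd_int_int_eq)
  from assms obtain k where k: "c = int (gcd s t) * k" by (elim dvdE)
  \<comment> \<open>The length \<open>z * k\<close> solves the congruence; adding \<open>r\<close>
    to \<open>M\<close> yields its representative in the window of \<open>s + t\<close> lengths
    starting at \<open>M\<close>.\<close>
  define r where "r = (z * k - int M) mod int (s + t)"
  have r: "0 \<le> r" "r < int (s + t)" using s by (auto simp: r_def)
  have "[int M + r = int M + (z * k - int M)] (mod int (s + t))"
    unfolding r_def by (intro cong_add cong_refl) simp
  then have "[(int M + r) * int s = z * k * int s] (mod int (s + t))"
    by (intro cong_mult cong_refl) simp
  moreover have "[int s * z * k = c] (mod int (s + t))"
    unfolding k using z gcd by (intro cong_mult cong_refl) simp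
  ultimately have "[c = (int M + r) * int s] (mod int (s + t))"
    by (metis (no_types, lifting) cong_sym cong_trans mult.commute mult.left_commute)
  moreover have "int (M + nat r) = int M + r" using r by simp
  ultimately show ?thesis
    using r by (intro exI[of _ "M + nat r"]) auto
qed

text \<open>One arc of displacement \<open>y\<close> takes the place of a step \<open>+s\<close>,
  which changes the total displacement by \<open>y - s\<close>.\<close>

lemma offset_step:
  assumes "\<And>u. u \<in> {1..n} \<Longrightarrow> \<exists>w w'. (w, w') \<in> toeplitz_arcs n S T \<and> int w' - int w = y \<and>
    int (gcd s t) dvd int w - int u"
  shows "offset (y - int s)"
proof -
  obtain M where M: "\<And>l u v. l \<ge> M \<Longrightarrow> u \<in> {1..n} \<Longrightarrow> v \<in> {1..n} \<Longrightarrow>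
    [int v - int u = int l * int s + 0] (mod int (s + t)) \<Longrightarrow> (u, v) \<in> toeplitz_arcs n S T ^^ l"
    using offset_0 unfolding offset_def eventually_sequentially by blast
  show ?thesis
    unfolding offset_def eventually_sequentially
  \<comment> \<open>Fewer than \<open>M + (s + t)\<close> steps lead to \<open>w\<close>, one is the
    special arc, and at least \<open>M\<close> are left to reach \<open>v\<close>.\<close>
  proof (intro exI[of _ "M + (s + t) + 1 + M"] allI impI ballI)
    fix l u v
    assume l: "M + (s + t) + 1 + M \<le> l" and u: "u \<in> {1..n}" and v: "v \<in> {1..n}"
      and uv: "[int v - int u = int l * int s + (y - int s)] (mod int (s + t))"
    obtain w w' where w: "(w, w') \<in> toeplitz_arcs n S T" "int w' - int w = y"
      "int (gcd s t) dvd int w - int u"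
      using assms u by blast
    then have mem: "w \<in> {1..n}" "w' \<in> {1..n}" by (auto simp: toeplitz_arcs_def)
    obtain k where k: "k \<ge> M" "k < M + (s + t)"
      "[int w - int u = int k * int s] (mod int (s + t))"
      using ex_length_cong w(3) by blast
    then have "(u, w) \<in> toeplitz_arcs n S T ^^ k" using M u mem by simp
    then have uw': "(u, w') \<in> toeplitz_arcs n S T ^^ Suc k" using w(1) by auto
    have "[int v - int u - (int w - int u) - y =
        int l * int s + (y - int s) - int k * int s - y] (mod int (s + t))"
      using uv k by (intro cong_diff cong_refl)
    moreover have "int v - int u - (int w - int u) - y = int v - int w'"
      using w(2) by simp
    moreover have "int l * int s + (y - int s) - int k * int s - y = int (l - Suc k) * int s + 0"
      using l k by (simp add: of_nat_diff algebra_simps)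
    ultimately have "[int v - int w' = int (l - Suc k) * int s + 0] (mod int (s + t))"
      by (simp only:)
    then have "(w', v) \<in> toeplitz_arcs n S T ^^ (l - Suc k)"
      using l k v mem by (intro M) auto
    with uw' have "(u, v) \<in> toeplitz_arcs n S T ^^ (Suc k + (l - Suc k))"
      unfolding relpow_add by blast
    then show "(u, v) \<in> toeplitz_arcs n S T ^^ l" using l k by simp
  qed
qed

lemma gcd_bounds: "0 < gcd s t" "gcd s t < n"
proof -
  show "0 < gcd s t" using s by simp
  have "gcd s t \<le> s" using s by (simp add: gcd_le1_nat)
  then show "gcd s t < n" using t sum_le by linarith
qed

lemma offset_S:
  assumes "x \<in> S"
  shows "offset (int x - int s)"
proof (rule offset_step)
  fix u assume u: "u \<in> {1..n}"
  \<comment> \<open>The representative of \<open>u\<close> modulo \<open>gcd s t\<close> among the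
    lowest \<open>gcd s t\<close> vertices: from there \<open>+x\<close> ends at most at
    \<open>n\<close>.\<close>
  define w where "w = (u - 1) mod gcd s t + 1"
  have "w \<le> gcd s t" using gcd_bounds by (simp add: w_def Suc_leI)
  then have "(w, w + x) \<in> toeplitz_arcs n S T"
    using assms S_le[OF assms] gcd_bounds by (auto simp: toeplitz_arcs_def w_def)
  moreover have "int (u - 1) = int ((u - 1) div gcd s t) * int (gcd s t) + int ((u - 1) mod gcd s t)"
    by (metis div_mult_mod_eq of_nat_add of_nat_mult)
  then have "int w - int u = int (gcd s t) * - int ((u - 1) div gcd s t)"
    using u by (simp add: w_def of_nat_diff algebra_simps)
  ultimately show "\<exists>w w'. (w, w') \<in> toeplitz_arcs n S T \<and> int w' - int w = int x \<and>
      int (gcd s t) dvd int w - int u"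
    by (intro exI[of _ w] exI[of _ "w + x"]) auto
qed

lemma offset_T:
  assumes "x \<in> T"
  shows "offset (- int x - int s)"
proof (rule offset_step)
  fix u assume u: "u \<in> {1..n}"
  \<comment> \<open>Mirror image: \<open>n - r\<close> represents \<open>u\<close> among the highest
    \<open>gcd s t\<close> vertices, so \<open>-x\<close> stays at least 1.\<close>
  define r where "r = (n - u) mod gcd s t"
  have r: "r < gcd s t" using gcd_bounds by (simp add: r_def)
  have x: "x + r < n" using r T_le[OF assms] gcd_bounds by linarith
  then have "n - r = (n - r - x) + x" "n - r \<in> {1..n}" "n - r - x \<in> {1..n}" by auto
  then have "(n - r, n - r - x) \<in> toeplitz_arcs n S T"
    using assms unfolding toeplitz_arcs_def by blast
  moreover have "int (n - u) = int ((n - u) div gcd s t) * int (gcd s t) + int r"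
    unfolding r_def by (metis div_mult_mod_eq of_nat_add of_nat_mult)
  then have "int (n - r) - int u = int (gcd s t) * int ((n - u) div gcd s t)"
    using u x by (simp add: of_nat_diff algebra_simps)
  moreover have "int (n - r - x) - int (n - r) = - int x" using x by linarith
  ultimately show "\<exists>w w'. (w, w') \<in> toeplitz_arcs n S T \<and> int w' - int w = - int x \<and>
      int (gcd s t) dvd int w - int u"
    by (intro exI[of _ "n - r"] exI[of _ "n - r - x"]) auto
qed

lemma offset_Gcd: "offset (k * int (Gcd {a + b |a b. a \<in> S \<and> b \<in> T}))"
proof (rule offset_mult)
  have "finite S" "finite T"
    using S_le T_le by (meson atMost_iff finite_atMost finite_subset subsetI)+
  then have "finite {a + b |a b. a \<in> S \<and> b \<in> T}"
    by (rule finite_image_set2[of "\<lambda>a. a \<in> S" "\<lambda>b. b \<in> T", simplified])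
  \<comment> \<open>In \<open>(a - s) - (- b - s) = a + b\<close> the contributions of
    \<open>s\<close> cancel.\<close>
  moreover have "offset (int (a + b))" if "a \<in> S" "b \<in> T" for a b
    using offset_add[OF offset_S[OF that(1)] offset_mult[OF offset_T[OF that(2)], of "-1"]]
    by simp
  ultimately have "int (Gcd {a + b |a b. a \<in> S \<and> b \<in> T}) \<in> Collect offset"
    by (intro Gcd_mem_int_subgroup) (auto intro: offset_0 offset_add offset_mult)
  then show "offset (int (Gcd {a + b |a b. a \<in> S \<and> b \<in> T}))" by simp
qed

text \<open>As \<open>D\<close> divides \<open>s + t\<close>, the congruence modulo \<open>D\<close>
  splits into finitely many congruences modulo \<open>s + t\<close>, whose offsets are multiples of
  \<open>D\<close>; finitely many thresholds have a common bound.\<close>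

lemma eventually_relpow:
  defines "D \<equiv> Gcd {a + b |a b. a \<in> S \<and> b \<in> T}"
  shows "\<forall>\<^sub>F l in sequentially. \<forall>u\<in>{1..n}. \<forall>v\<in>{1..n}.
    [int v - int u = int l * int s] (mod int D) \<longrightarrow> (u, v) \<in> toeplitz_arcs n S T ^^ l"
proof -
  have D: "int D dvd int (s + t)"
    unfolding of_nat_dvd_iff D_def using s t by (intro Gcd_dvd) blast
  have "\<forall>\<^sub>F l in sequentially. \<forall>x\<in>{x\<in>{0..<int (s + t)}. int D dvd x}. \<forall>u\<in>{1..n}. \<forall>v\<in>{1..n}.
      [int v - int u = int l * int s + x] (mod int (s + t)) \<longrightarrow> (u, v) \<in> toeplitz_arcs n S T ^^ l"
  proof (rule eventually_ball_finite; (rule ballI)?)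
    fix x assume "x \<in> {x\<in>{0..<int (s + t)}. int D dvd x}"
    then have "int D dvd x" by simp
    then obtain k where "x = k * int D" by (metis dvdE mult.commute)
    then have "offset x" using offset_Gcd by (simp add: D_def)
    then show "\<forall>\<^sub>F l in sequentially. \<forall>u\<in>{1..n}. \<forall>v\<in>{1..n}.
      [int v - int u = int l * int s + x] (mod int (s + t)) \<longrightarrow> (u, v) \<in> toeplitz_arcs n S T ^^ l"
      unfolding offset_def .
  qed (rule finite_subset[of _ "{0..<int (s + t)}"], auto)
  then show ?thesis
  proof (rule eventually_mono, intro ballI impI)
    fix l u v
    assume *: "\<forall>x\<in>{x\<in>{0..<int (s + t)}. int D dvd x}. \<forall>u\<in>{1..n}. \<forall>v\<in>{1..n}.
      [int v - int u = int l * int s + x] (mod int (s + t)) \<longrightarrow> (u, v) \<in> toeplitz_arcs n S T ^^ l"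
      and uv: "u \<in> {1..n}" "v \<in> {1..n}" "[int v - int u = int l * int s] (mod int D)"
    define x where "x = (int v - int u - int l * int s) mod int (s + t)"
    have "int D dvd x"
      using uv D by (simp add: x_def dvd_mod_iff cong_iff_dvd_diff)
    moreover have "0 \<le> x" "x < int (s + t)" using s by (auto simp: x_def)
    moreover have "[int l * int s + x = int l * int s + (int v - int u - int l * int s)]
        (mod int (s + t))"
      unfolding x_def by (intro cong_add cong_refl) simp
    then have "[int v - int u = int l * int s + x] (mod int (s + t))"
      by (simp add: cong_sym)
    ultimately show "(u, v) \<in> toeplitz_arcs n S T ^^ l"
      using * uv by auto
  qed
qed

end

section \<open>Transfer to walks in the digraph of the matrix\<close>

theorem theorem5p2:
  fixes n :: nat and S T :: "nat set"
  assumes "n > 0"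
    and "S \<noteq> {}" and "S \<subseteq> {1..n - 1}"
    and "T \<noteq> {}" and "T \<subseteq> {1..n - 1}"
    and "Min S + Min T \<le> n"
    and "max (Max S) (Max T) \<le> n - gcd (Min S) (Min T)"
  shows "toeplitz_mat (toeplitz_of n S T) \<and> walk_ensured n S T"
proof
  show "toeplitz_mat (toeplitz_of n S T)" by (rule toeplitz_mat_toeplitz_of)
  have fin: "finite S" "finite T"
    using assms(3,5) finite_subset by blast+
  then have mem: "Min S \<in> S" "Min T \<in> T"
    using assms(2,4) by auto
  interpret toeplitz_pair n S T "Min S" "Min T"
  proof
    show "x \<le> n - gcd (Min S) (Min T)" if "x \<in> S" for x
      using Max_ge[OF fin(1) that] assms(7) by linarith
    show "x \<le> n - gcd (Min S) (Min T)" if "x \<in> T" for x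
      using Max_ge[OF fin(2) that] assms(7) by linarith
    show "Min S > 0" using subsetD[OF assms(3) mem(1)] by simp
    show "Min T > 0" using subsetD[OF assms(5) mem(2)] by simp
  qed (use mem assms in auto)
  let ?D = "Gcd {s + t |s t. s \<in> S \<and> t \<in> T}"
  obtain M where M: "\<And>l u v. l \<ge> M \<Longrightarrow> u \<in> {1..n} \<Longrightarrow> v \<in> {1..n} \<Longrightarrow>
      [int v - int u = int l * int (Min S)] (mod int ?D) \<Longrightarrow> (u, v) \<in> toeplitz_arcs n S T ^^ l"
    using eventually_relpow unfolding eventually_sequentially by blast
  \<comment> \<open>The threshold becomes \<open>Suc M\<close> because \<open>walk_ensured\<close>
    asks for a positive one.\<close>
  have "\<exists>p. pre_digraph.awalk (with_proj (mat_digraph (toeplitz_of n S T))) u p v \<and> length p = l"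
    if "l \<ge> Suc M" "u \<in> {1..n}" "v \<in> {1..n}"
      "[int v - int u = int l * int (Min S)] (mod int ?D)" for l u v
  proof (rule awalk_of_relpow)
    show "(u, v) \<in> parcs (mat_digraph (toeplitz_of n S T)) ^^ l"
      unfolding parcs_mat_digraph_toeplitz_of using that by (intro M) auto
    show "u \<in> pverts (mat_digraph (toeplitz_of n S T))"
      using that by (simp add: pverts_mat_digraph_toeplitz_of)
    show "parcs (mat_digraph (toeplitz_of n S T)) \<subseteq>
        pverts (mat_digraph (toeplitz_of n S T)) \<times> pverts (mat_digraph (toeplitz_of n S T))"
      unfolding parcs_mat_digraph_toeplitz_of pverts_mat_digraph_toeplitz_of
      by (auto simp: toeplitz_arcs_def)
  qed
  then show "walk_ensured n S T"
    unfolding walk_ensured_def by (intro exI[of _ "Suc M"]) auto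
qed

end
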